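(* Let $\lambda>0$, let $\psi:\mathbb{R}\to\mathbb{R}$ be a convex function, and let $z$, $H$, $\Phi$, $A$, $\mathcal{C}$ be the data and operators described in the context. Let $$f_1(\alpha)=F(H\Phi\alpha),\quad F(\eta)=\sum_{i=1}^n \frac12\left(z_i-2\sqrt{\eta_i+\tfrac38}\right)^2,\qquad f_2(\alpha)=\imath_{\mathcal{C}}(\Phi\alpha)+\lambda\sum_{i=1}^{L}\psi(\alpha_i),$$ and let $J=f_1+f_2$. Assume that $J$ is coercive. Let $(\mu_t)_{t\ge0}$ be a sequence in $]0,+\infty[$ such that $$0<\inf_t\mu_t\le\sup_t\mu_t<\frac{\left(\tfrac32\right)^{3/2}}{2A\,\|H\|_2^2\,\|z\|_\infty}.$$ Fix an arbitrary $\alpha_0\in\mathcal{H}$, where $\mathcal{H}=\mathbb{R}^L$ is the space of coefficient vectors, and for every $t\ge0$ set $$\alpha_{t+1}=\operatorname{prox}_{\mu_t f_2}\bigl(\alpha_t-\mu_t\nabla f_1(\alpha_t)\bigr),$$ where $$\nabla f_1(\alpha)=\Phi^{\mathrm T}H^{*}\,\nabla F(H\Phi\alpha),\qquad \nabla F(\eta)=\left(\frac{-z_i}{\sqrt{\eta_i+3/8}}+2\right)_{1\le i\le n}.$$ Then $(\alpha_t)_{t\ge0}$ converges (weakly) to a solution of the problem $(\mathsf{P}_{\lambda,\psi}):\ \operatorname{arg\,min}_{\alpha}J(\alpha)$, i.e. to a minimizer of $J$.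
   Context: Images of size $\sqrt n\times\sqrt n$ are identified with vectors of $\mathbb{R}^n$. $h$ is a point spread function and $H$ is the linear operator $Hx=h\circledast x$ of circular convolution with $h$, with adjoint $H^*$ and spectral norm $\|H\|_2$. The observation $y=(y_i)_{1\le i\le n}$ is a vector of counts, each $y_i$ being a realization of an independent Poisson random variable with mean $(h\circledast x)_i$, where $x$ is the unknown image, and $z_i=2\sqrt{y_i+3/8}$ for $1\le i\le n$; $\|z\|_\infty=\max_i|z_i|$. The dictionary $\Phi$ is a real $n\times L$ matrix, $L\ge n$, whose columns have unit $\ell_2$-norm and which is either an orthonormal basis or a tight frame, i.e. $\Phi\Phi^{\mathrm T}=A\,\mathbf{I}$ for some constant $A>0$ (with $A=1$ for an orthonormal basis). An image is represented as $x=\Phi\alpha$ with $\alpha\in\mathbb{R}^L$. $\mathcal{C}=\{x\in\mathbb{R}^n: x_i\ge0\text{ for all }i\}$ is the positive orthant, and $\imath_{\mathcal{C}}$ is its indicator function, equal to $0$ on $\mathcal{C}$ and $+\infty$ outside. The function $J$ is coercive if $J(\alpha)\to+\infty$ as $\|\alpha\|_2\to+\infty$. The problem is treated as an instance of minimizing $f_1+f_2$ with $f_1,f_2$ proper, lower semicontinuous and convex and $f_1$ differentiable with Lipschitz gradient. For a proper lower semicontinuous convex function $\varphi:\mathcal{H}\to\,]-\infty,+\infty]$, the proximity operator $\operatorname{prox}_\varphi:\mathcal{H}\to\mathcal{H}$ sends $\alpha$ to the unique minimizer of $\beta\mapsto\varphi(\beta)+\tfrac12\|\alpha-\beta\|_2^2$.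 *)

theory Defs
  imports
    "HOL-Analysis.Analysis"
    "Berlekamp_Zassenhaus.Finite_Field"
begin

text \<open>
  Images of size \<open>\<surd>n \<times> \<surd>n\<close> are indexed by \<open>(\<int>/m) \<times> (\<int>/m)\<close> with \<open>m = \<surd>n = CARD('m)\<close>: addition and
  subtraction on \<^typ>\<open>'m::finite mod_ring\<close> are modulo \<open>CARD('m)\<close> and act componentwise on pairs, so
  index subtraction in the convolution below wraps around in both coordinates.
\<close>

type_synonym 'm pixel = "'m mod_ring \<times> 'm mod_ring"
type_synonym 'm image = "real ^ 'm pixel"

definition circ_conv :: "'m::finite image \<Rightarrow> 'm image \<Rightarrow> 'm image"  (infixl "\<circledast>" 70)
  where "h \<circledast> x = (\<chi> i. \<Sum>j\<in>UNIV. h $ j * x $ (i - j))"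

text \<open>
  Nonnegativity of the point spread function makes \<open>h \<circledast> x\<close> a legitimate vector of Poisson means for
  every nonnegative image \<open>x\<close>, and keeps the square roots in the fidelity term meaningful there.
  No normalisation is imposed.
\<close>

definition psf :: "'m::finite image \<Rightarrow> bool"
  where "psf h \<longleftrightarrow> (\<forall>i. 0 \<le> h $ i) \<and> h \<noteq> 0"

definition anscombe :: "nat ^ 'n \<Rightarrow> real ^ 'n"
  where "anscombe y = (\<chi> i. 2 * sqrt (real (y $ i) + 3/8))"

text \<open>An orthonormal basis is the case \<open>A = 1\<close> with equally many rows and columns.\<close>

definition tight_frame_dictionary :: "real \<Rightarrow> real ^ 'l ^ 'n \<Rightarrow> bool"
  where "tight_frame_dictionary A \<Phi> \<longleftrightarrow>
    CARD('n) \<le> CARD('l) \<and> (\<forall>j. norm (column j \<Phi>) = 1) \<and> 0 < A \<and> \<Phi> ** transpose \<Phi> = mat A"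

definition positive_orthant :: "(real ^ 'n) set"
  where "positive_orthant = {x. \<forall>i. 0 \<le> x $ i}"

definition indicator_fun :: "'a set \<Rightarrow> 'a \<Rightarrow> ereal"
  where "indicator_fun S x = (if x \<in> S then 0 else \<infinity>)"

definition fidelity :: "real ^ 'n \<Rightarrow> real ^ 'n \<Rightarrow> real"
  where "fidelity z \<eta> = (\<Sum>i\<in>UNIV. 1/2 * (z $ i - 2 * sqrt (\<eta> $ i + 3/8))\<^sup>2)"

definition grad_fidelity :: "real ^ 'n \<Rightarrow> real ^ 'n \<Rightarrow> real ^ 'n"
  where "grad_fidelity z \<eta> = (\<chi> i. - z $ i / sqrt (\<eta> $ i + 3/8) + 2)"

definition f1 :: "'m::finite image \<Rightarrow> real ^ 'l ^ 'm pixel \<Rightarrow> 'm image \<Rightarrow> real ^ 'l \<Rightarrow> real"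
  where "f1 h \<Phi> z \<alpha> = fidelity z (h \<circledast> (\<Phi> *v \<alpha>))"

text \<open>
  The formula is the gradient of \<^const>\<open>f1\<close> where all \<open>(H\<Phi>\<alpha>)\<^sub>i > -3/8\<close>, in particular when \<open>\<Phi>\<alpha>\<close> is
  nonnegative (lemma \<open>GDERIV_f1\<close> below).  Elsewhere \<^const>\<open>sqrt\<close> and division take their default
  values; the iteration meets this only at an initial point outside the domain, since every
  later iterate is a value of the proximity operator.  The objective itself is unaffected, as \<open>f2\<close> is
  infinite wherever \<open>\<Phi>\<alpha>\<close> is not nonnegative.
\<close>

definition grad_f1 :: "'m::finite image \<Rightarrow> real ^ 'l ^ 'm pixel \<Rightarrow> 'm image \<Rightarrow> real ^ 'l \<Rightarrow> real ^ 'l"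
  where "grad_f1 h \<Phi> z \<alpha> =
    transpose \<Phi> *v adjoint ((\<circledast>) h) (grad_fidelity z (h \<circledast> (\<Phi> *v \<alpha>)))"

definition f2 :: "real ^ 'l ^ 'n \<Rightarrow> real \<Rightarrow> (real \<Rightarrow> real) \<Rightarrow> real ^ 'l \<Rightarrow> ereal"
  where "f2 \<Phi> lam \<psi> \<alpha> =
    indicator_fun positive_orthant (\<Phi> *v \<alpha>) + ereal (lam * (\<Sum>i\<in>UNIV. \<psi> (\<alpha> $ i)))"

definition coercive :: "('a::real_normed_vector \<Rightarrow> ereal) \<Rightarrow> bool"
  where "coercive J \<longleftrightarrow> (J \<longlongrightarrow> \<infinity>) at_infinity"

abbreviation is_minimizer :: "('a \<Rightarrow> ereal) \<Rightarrow> 'a \<Rightarrow> bool"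
  where "is_minimizer J \<equiv> is_arg_min J (\<lambda>_. True)"

definition prox :: "('a::real_normed_vector \<Rightarrow> ereal) \<Rightarrow> 'a \<Rightarrow> 'a"
  where "prox \<phi> \<alpha> = (THE \<beta>. is_minimizer (\<lambda>\<beta>. \<phi> \<beta> + ereal (1/2 * (norm (\<alpha> - \<beta>))\<^sup>2)) \<beta>)"

lemma linear_circ_conv: "linear ((\<circledast>) h)"
  by (rule linearI)
    (simp_all add: circ_conv_def vec_eq_iff algebra_simps sum.distrib sum_distrib_left)

lemma GDERIV_f1:
  assumes "\<And>i. (h \<circledast> (\<Phi> *v \<alpha>)) $ i > - 3/8"
  shows "GDERIV (f1 h \<Phi> z) \<alpha> :> grad_f1 h \<Phi> z \<alpha>"
proof -
  let ?T = "\<lambda>\<alpha>. h \<circledast> (\<Phi> *v \<alpha>)"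
  have lin: "linear ?T"
    using linear_compose[OF matrix_vector_mul_linear linear_circ_conv] by (simp add: o_def)
  have T: "(?T has_derivative ?T) (at \<alpha>)"
    using lin linear_conv_bounded_linear bounded_linear_imp_has_derivative by blast
  have Ti: "((\<lambda>\<alpha>. ?T \<alpha> $ i) has_derivative (\<lambda>v. ?T v $ i)) (at \<alpha>)" for i
    using bounded_linear.has_derivative[OF bounded_linear_vec_nth T] .
  have "((\<lambda>\<alpha>. 1/2 * (z $ i - 2 * sqrt (?T \<alpha> $ i + 3/8))\<^sup>2)
      has_derivative (\<lambda>v. ?T v $ i * grad_fidelity z (?T \<alpha>) $ i)) (at \<alpha>)" for i
  proof -
    have pos: "0 < ?T \<alpha> $ i + 3/8" using assms[of i] by linarith
    then have sq: "sqrt (?T \<alpha> $ i + 3/8) > 0" by simp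
    show ?thesis
      apply (rule derivative_eq_intros Ti pos refl)+
      using sq by (auto simp: fun_eq_iff grad_fidelity_def field_simps)
  qed
  then have "(f1 h \<Phi> z has_derivative (\<lambda>v. ?T v \<bullet> grad_fidelity z (?T \<alpha>))) (at \<alpha>)"
    unfolding f1_def fidelity_def inner_vec_def inner_real_def by (rule has_derivative_sum)
  moreover have "?T v \<bullet> w = v \<bullet> (transpose \<Phi> *v adjoint ((\<circledast>) h) w)" for v w
    using adjoint_works[OF linear_circ_conv, of "\<Phi> *v v" h w]
    by (simp add: inner_commute dot_lmul_matrix flip: vector_transpose_matrix)
  ultimately show ?thesis
    by (simp add: gderiv_def grad_f1_def inner_commute)
qed

end

theory Submission
  imports Defs
begin

text \<open>
  Let \<open>S\<close> be the closed convex set of coefficient vectors with a nonnegative synthesis \<open>\<Phi>\<alpha>\<close>, and let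
  \<open>g = \<lambda> \<Sum>\<^sub>i \<psi>(\<alpha>\<^sub>i)\<close>, a finite convex and hence continuous function.  On \<open>S\<close> the objective is
  \<open>f\<^sub>1 + g\<close>, outside \<open>S\<close> it is infinite.  Both the minimizers of the objective and the values of the
  proximity operator are governed by the first-order variational inequality of
  \<open>minimizer_variational_inequality\<close>: a point \<open>p\<close> of \<open>S\<close> minimizes \<open>f + g\<close> over \<open>S\<close> only if
  \<open>-\<nabla>f(p) \<bullet> (y - p) \<le> g(y) - g(p)\<close> for all \<open>y\<close> in \<open>S\<close>, and for convex \<open>f\<close> this is also sufficient.

  The textbook convergence theorem for forward-backward splitting asks for a Lipschitz gradient on
  the whole space and turns this into cocoercivity by the Baillon-Haddad theorem.  Here \<open>f\<^sub>1\<close> is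
  well-behaved on \<open>S\<close> but not on the whole space, so that theorem does not apply.  Cocoercivity on
  \<open>S\<close>, that is,
  \<open>b \<parallel>\<nabla>f\<^sub>1(u) - \<nabla>f\<^sub>1(v)\<parallel>\<^sup>2 \<le> (\<nabla>f\<^sub>1(u) - \<nabla>f\<^sub>1(v)) \<bullet> (u - v)\<close> for some \<open>b > 0\<close>,
  can be had directly.  The fidelity is separable, and the derivative \<open>2 - z\<^sub>i / \<surd>s\<close> of each summand,
  as a function of \<open>s = \<eta>\<^sub>i + 3/8\<close>, is increasing with slope at most
  \<open>z\<^sub>i / (2 (3/8)\<^bsup>3/2\<^esup>)\<close> for \<open>s \<ge> 3/8\<close>.  In one dimension monotone and Lipschitz imply cocoercive
  on any interval, and cocoercivity adds up over the coordinates and survives composition with the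
  linear map \<open>H\<Phi>\<close>, at the price of the factor \<open>A \<parallel>H\<parallel>\<^sup>2\<close>, which bounds \<open>\<parallel>H\<Phi>\<parallel>\<^sup>2\<close>
  (\<open>grad_f1_cocoercive\<close>).  The upper bound on the step sizes says exactly that their supremum is
  below \<open>2b\<close> for the constant \<open>b\<close> found in this way.

  Under this bound one step brings the iterate closer to every solution, by an amount
  proportional to the square of the step length (\<open>forward_backward_step\<close>).  Hence the iterates
  are bounded and consecutive ones approach each other, so the variational inequality of the
  proximal step passes to the limit along a convergent subsequence: every cluster point is a
  solution.  Since the distance to this solution decreases and has a subsequence tending to zero,
  the whole sequence converges to it (\<open>forward_backward_converges\<close>).  Coercivity of the objective
  serves to provide a first solution.  The initial point may lie outside \<open>S\<close>, but all later iterates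
  are values of the proximity operator and lie in \<open>S\<close>, so the argument is applied to the shifted
  sequence.
\<close>

section \<open>Minimization over a closed set\<close>

text \<open>
  Passes between minimization of an extended-valued function, the form in which the objective and
  the proximity operator are given, and constrained minimization of a real-valued one.
\<close>

lemma is_minimizer_extended_iff:
  fixes F :: "'a \<Rightarrow> real"
  assumes "S \<noteq> {}"
  shows "is_minimizer (\<lambda>x. if x \<in> S then ereal (F x) else \<infinity>) p
    \<longleftrightarrow> p \<in> S \<and> (\<forall>y\<in>S. F p \<le> F y)"
  using assms by (auto simp: is_arg_min_def not_less split: if_splits)

lemma continuous_coercive_attains_inf:
  fixes F :: "'a::euclidean_space \<Rightarrow> real"
  assumes "closed S" "x0 \<in> S" "continuous_on S F"
    and far: "\<And>x. x \<in> S \<Longrightarrow> R \<le> norm x \<Longrightarrow> F x0 \<le> F x"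
  shows "\<exists>p\<in>S. \<forall>y\<in>S. F p \<le> F y"
proof -
  let ?K = "S \<inter> cball 0 (max R (norm x0))"
  have "compact ?K" using assms(1) by (simp add: closed_Int_compact)
  moreover have "x0 \<in> ?K" using assms(2) by simp
  ultimately obtain p where p: "p \<in> ?K" "\<forall>y\<in>?K. F p \<le> F y"
    using continuous_attains_inf[of ?K F] continuous_on_subset[OF assms(3)] by blast
  have "F p \<le> F y" if "y \<in> S" for y
  proof (cases "y \<in> ?K")
    case False
    then have "F x0 \<le> F y" using far[OF that] that by auto
    then show ?thesis using bspec[OF p(2) \<open>x0 \<in> ?K\<close>] by linarith
  qed (use p in auto)
  then show ?thesis using p(1) by blast
qed

text \<open>
  A convex function is bounded on the unit sphere, by continuity; moving from a point of the sphere
  through the origin to \<open>x\<close>, convexity prevents it from dropping faster than linearly.  This makes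
  the quadratic term dominate in the objective defining the proximity operator.
\<close>

lemma convex_on_UNIV_ge_neg_norm:
  fixes G :: "'a::euclidean_space \<Rightarrow> real"
  assumes "convex_on UNIV G"
  obtains C where "\<And>x. G 0 - C * norm x \<le> G x"
proof -
  have "continuous_on (sphere 0 1) G"
    using convex_on_continuous[OF open_UNIV assms] continuous_on_subset by blast
  then have "bounded (G ` sphere 0 1)"
    using compact_continuous_image[of "sphere (0::'a) 1" G] compact_imp_bounded by simp
  then obtain B where "\<forall>u\<in>sphere 0 1. \<bar>G u\<bar> \<le> B"
    by (auto simp: bounded_iff)
  then have B: "\<bar>G u\<bar> \<le> B" if "norm u = 1" for u
    using that by simp
  have "G 0 - (B - G 0) * norm x \<le> G x" for x
  proof (cases "x = 0")
    case False
    define r where "r = norm x"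
    have r: "r > 0" using False by (simp add: r_def)
    let ?u = "- (1/r) *\<^sub>R x"
    \<comment> \<open>the origin lies between \<open>x\<close> and the unit vector pointing the other way\<close>
    have "G ((r/(1+r)) *\<^sub>R ?u + (1/(1+r)) *\<^sub>R x) \<le> (r/(1+r)) * G ?u + (1/(1+r)) * G x"
    proof -
      have "1 - 1/(1+r) = r/(1+r)" using r by (simp add: field_simps)
      then show ?thesis using convex_onD[OF assms, of "1/(1+r)" ?u x] r by simp
    qed
    moreover have "(r/(1+r)) *\<^sub>R ?u + (1/(1+r)) *\<^sub>R x = 0"
      using r by simp
    ultimately have "G 0 \<le> r/(1+r) * G ?u + 1/(1+r) * G x"
      by (simp only:)
    also have "\<dots> = (r * G ?u + G x) / (1+r)"
      by (simp add: add_divide_distrib)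
    finally have "G 0 \<le> (r * G ?u + G x) / (1+r)" .
    then have "(1+r) * G 0 \<le> r * G ?u + G x"
      using r by (simp add: field_simps)
    moreover have "r * G ?u \<le> r * B"
      using B[of ?u] r by (intro mult_left_mono) (auto simp: r_def)
    ultimately show ?thesis by (simp add: algebra_simps flip: r_def)
  qed simp
  then show thesis by (rule that)
qed

text \<open>
  Along the segment from \<open>p\<close> to \<open>y\<close>, the difference quotients of \<open>f\<close> at \<open>p\<close> are bounded below by
  \<open>-(g y - g p)\<close>, because \<open>g\<close> lies below its chord; their limit is the directional derivative.
\<close>

lemma minimizer_variational_inequality:
  fixes f g :: "'a::real_inner \<Rightarrow> real"
  assumes f: "GDERIV f p :> d"
    and g: "convex_on S g"
    and min: "\<And>y. y \<in> S \<Longrightarrow> f p + g p \<le> f y + g y"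
    and p: "p \<in> S" and y: "y \<in> S"
  shows "- (d \<bullet> (y - p)) \<le> g y - g p"
proof -
  let ?l = "\<lambda>t::real. p + t *\<^sub>R (y - p)"
  have "(f has_derivative (\<lambda>v. v \<bullet> d)) (at (?l 0))"
    using f by (simp add: gderiv_def inner_commute)
  moreover have "(?l has_derivative (\<lambda>t. t *\<^sub>R (y - p))) (at 0)"
    by (auto intro!: derivative_eq_intros)
  ultimately have "((\<lambda>t. f (?l t)) has_derivative (\<lambda>t. (t *\<^sub>R (y - p)) \<bullet> d)) (at 0)"
    using has_derivative_compose[of ?l "\<lambda>t. t *\<^sub>R (y - p)" 0 UNIV f "\<lambda>v. v \<bullet> d"] by simp
  then have "((\<lambda>t. f (?l t)) has_real_derivative (d \<bullet> (y - p))) (at 0)"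
    by (simp add: has_field_derivative_def inner_commute mult.commute[of _ "d \<bullet> _"]
        mult_commute_abs)
  then have "((\<lambda>t. (f (?l t) - f p) / t) \<longlongrightarrow> d \<bullet> (y - p)) (at 0)"
    by (simp add: DERIV_def)
  then have lim: "((\<lambda>t. (f (?l t) - f p) / t) \<longlongrightarrow> d \<bullet> (y - p)) (at_right 0)"
    by (rule filterlim_mono) (auto simp: at_le)
  have "- (g y - g p) \<le> (f (?l t) - f p) / t" if t: "0 < t" "t < 1" for t
  proof -
    have l: "?l t = (1 - t) *\<^sub>R p + t *\<^sub>R y" by (simp add: algebra_simps)
    have "?l t \<in> S"
      unfolding l using convex_on_imp_convex[OF g] p y t by (intro convexD_alt) auto
    then have "f p + g p \<le> f (?l t) + g (?l t)" by (rule min)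
    also have "g (?l t) \<le> (1 - t) * g p + t * g y"
      unfolding l using t p y by (intro convex_onD[OF g]) auto
    finally have "- (g y - g p) * t \<le> f (?l t) - f p" by (simp add: algebra_simps)
    then show ?thesis using t by (simp add: pos_le_divide_eq)
  qed
  then have "\<forall>\<^sub>F t in at_right 0. - (g y - g p) \<le> (f (?l t) - f p) / t"
    by (auto simp: eventually_at_right_field intro!: exI[of _ 1])
  then have "- (g y - g p) \<le> d \<bullet> (y - p)"
    using tendsto_lowerbound[OF lim] by simp
  then show ?thesis by simp
qed

section \<open>The proximity operator\<close>

text \<open>
  The quadratic term has gradient \<open>p - u\<close> at \<open>p\<close>, so every minimizer of the proximal objective
  satisfies the stated inequality.  Existence comes from the linear lower bound on \<open>G\<close>, and
  adding the inequalities of two minimizers \<open>p\<close> and \<open>p'\<close>, each tested with the other, gives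
  \<open>(p - p') \<bullet> (p - p') \<le> 0\<close>: the description defining the operator denotes.
\<close>

lemma prox_variational_inequality:
  fixes G :: "'a::euclidean_space \<Rightarrow> real"
  assumes S: "closed S" "convex S" "S \<noteq> {}" and G: "convex_on UNIV G"
  defines "\<phi> \<equiv> \<lambda>\<beta>. if \<beta> \<in> S then ereal (G \<beta>) else \<infinity>"
  shows "prox \<phi> u \<in> S"
    and "y \<in> S \<Longrightarrow> (u - prox \<phi> u) \<bullet> (y - prox \<phi> u) \<le> G y - G (prox \<phi> u)"
proof -
  define q where "q = (\<lambda>\<beta>. 1/2 * (norm (u - \<beta>))\<^sup>2)"
  define M where "M = (\<lambda>p. p \<in> S \<and> (\<forall>y\<in>S. q p + G p \<le> q y + G y))"
  have prox_eq: "prox \<phi> u = (THE p. M p)"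
  proof -
    have "(\<lambda>\<beta>. \<phi> \<beta> + ereal (1/2 * (norm (u - \<beta>))\<^sup>2))
        = (\<lambda>\<beta>. if \<beta> \<in> S then ereal (q \<beta> + G \<beta>) else \<infinity>)"
      by (auto simp: \<phi>_def q_def fun_eq_iff)
    then show ?thesis
      unfolding prox_def M_def
      by (intro arg_cong[where f = The] ext) (simp only: is_minimizer_extended_iff[OF S(3)])
  qed
  have contG: "continuous_on UNIV G" using convex_on_continuous[OF open_UNIV G] .
  have GS: "convex_on S G" using G S(2) by (meson convex_on_subset top_greatest)
  have gq: "GDERIV q p :> - (u - p)" for p
    unfolding gderiv_def q_def power2_norm_eq_inner
    by (auto intro!: derivative_eq_intros simp: inner_commute algebra_simps)
  have VI: "(u - p) \<bullet> (y - p) \<le> G y - G p" if "M p" "y \<in> S" for p y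
    using minimizer_variational_inequality[OF gq GS, of p y] that
    by (auto simp: M_def inner_diff_left)
  have ex: "\<exists>p. M p"
  proof -
    obtain x0 where x0: "x0 \<in> S" using S(3) by blast
    obtain C where C: "\<And>x. G 0 - C * norm x \<le> G x"
      using convex_on_UNIV_ge_neg_norm[OF G] by blast
    define K where "K = q x0 + G x0 - G 0"
    \<comment> \<open>beyond radius \<open>R\<close> the term \<open>\<parallel>x\<parallel>\<^sup>2 / 2\<close> beats the linear terms and the constant \<open>K\<close> together\<close>
    define R where "R = max 1 (2 * (norm u + \<bar>C\<bar> + \<bar>K\<bar>))"
    have "q x0 + G x0 \<le> q x + G x" if "R \<le> norm x" for x
    proof -
      let ?r = "norm x"
      have r: "1 \<le> ?r" "2 * (norm u + \<bar>C\<bar> + \<bar>K\<bar>) \<le> ?r" using that by (auto simp: R_def)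
      have "(norm (u - x))\<^sup>2 \<ge> ?r\<^sup>2 - 2 * norm u * ?r"
      proof -
        have "(norm (u - x))\<^sup>2 = (norm u)\<^sup>2 - 2 * (u \<bullet> x) + ?r\<^sup>2"
          by (simp add: power2_norm_eq_inner inner_diff inner_commute)
        moreover have "u \<bullet> x \<le> norm u * ?r" by (rule norm_cauchy_schwarz)
        moreover have "0 \<le> (norm u)\<^sup>2" by simp
        ultimately show ?thesis by linarith
      qed
      then have "q x \<ge> 1/2 * (?r * ?r) - norm u * ?r" by (simp add: q_def power2_eq_square)
      moreover have "G x \<ge> G 0 - \<bar>C\<bar> * ?r"
        using C[of x] mult_right_mono[OF abs_ge_self[of C] norm_ge_zero[of x]] by linarith
      moreover have "1/2 * (?r * ?r) \<ge> (norm u + \<bar>C\<bar> + \<bar>K\<bar>) * ?r"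
        using mult_right_mono[OF r(2) norm_ge_zero[of x]] by (simp add: algebra_simps)
      moreover have "\<bar>K\<bar> \<le> \<bar>K\<bar> * ?r" using r(1) by (simp add: mult_le_cancel_left1)
      ultimately have "q x + G x \<ge> G 0 + K" by (simp add: algebra_simps)
      then show ?thesis by (simp add: K_def)
    qed
    moreover have "continuous_on S (\<lambda>x. q x + G x)"
      unfolding q_def by (intro continuous_intros continuous_on_subset[OF contG]) auto
    ultimately show ?thesis
      using continuous_coercive_attains_inf[OF S(1) x0, of "\<lambda>x. q x + G x" R]
      by (auto simp: M_def)
  qed
  have uniq: "p = p'" if "M p" "M p'" for p p'
  proof -
    have "(u - p) \<bullet> (p' - p) + (u - p') \<bullet> (p - p') \<le> 0"
      using VI[of p p'] VI[of p' p] that by (auto simp: M_def)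
    moreover have "(u - p) \<bullet> (p' - p) + (u - p') \<bullet> (p - p') = (p - p') \<bullet> (p - p')"
      by (simp add: inner_diff inner_commute)
    ultimately show ?thesis by (metis eq_iff_diff_eq_0 inner_eq_zero_iff inner_ge_zero order_antisym)
  qed
  have "M (prox \<phi> u)"
    unfolding prox_eq using ex uniq by (metis theI)
  then show "prox \<phi> u \<in> S"
    and "y \<in> S \<Longrightarrow> (u - prox \<phi> u) \<bullet> (y - prox \<phi> u) \<le> G y - G (prox \<phi> u)"
    using VI by (auto simp: M_def)
qed

section \<open>Convergence of forward-backward splitting\<close>

text \<open>
  Here \<open>p\<close> is the point reached from \<open>x\<close> with step size \<open>m\<close>, and \<open>x'\<close> is a solution.  Testing the
  inequality of \<open>p\<close> with \<open>x'\<close> and that of \<open>x'\<close> with \<open>p\<close>, the values of \<open>g\<close> cancel and leave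
  \<open>(x - p) \<bullet> (p - x') \<ge> m (D x - D x') \<bullet> (p - x')\<close>.  By cocoercivity the right-hand side
  is at least \<open>-m \<parallel>x - p\<parallel>\<^sup>2 / (4b)\<close>, and twice the left-hand side is the cross term in the
  expansion of \<open>\<parallel>(x - p) + (p - x')\<parallel>\<^sup>2\<close>.  The factor \<open>1 - m / (2b)\<close> is positive precisely when
  \<open>m < 2b\<close>.
\<close>

lemma forward_backward_step:
  fixes x p x' :: "'a::real_inner"
  assumes b: "b > 0" and m: "m > 0"
    and coco: "b * (norm (D x - D x'))\<^sup>2 \<le> (D x - D x') \<bullet> (x - x')"
    and step: "(x - m *\<^sub>R D x - p) \<bullet> (x' - p) \<le> m * (g x' - g p)"
    and sol: "- (D x' \<bullet> (p - x')) \<le> g p - g x'"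
  shows "(norm (p - x'))\<^sup>2 \<le> (norm (x - x'))\<^sup>2 - (1 - m / (2 * b)) * (norm (x - p))\<^sup>2"
proof -
  define d where "d = D x - D x'"
  have "m * - (D x' \<bullet> (p - x')) \<le> m * (g p - g x')"
    using sol m by (intro mult_left_mono) auto
  then have "(x - p) \<bullet> (p - x') \<ge> m * (d \<bullet> (p - x'))"
    using step unfolding d_def by (simp add: inner_diff inner_commute algebra_simps)
  moreover have "(norm (x - x'))\<^sup>2 = (norm (x - p))\<^sup>2 + (norm (p - x'))\<^sup>2 + 2 * ((x - p) \<bullet> (p - x'))"
    by (simp add: power2_norm_eq_inner inner_diff inner_commute)
  moreover have "d \<bullet> (p - x') \<ge> - ((norm (x - p))\<^sup>2 / (4 * b))"
  proof -
    have "d \<bullet> (p - x') = d \<bullet> (x - x') - d \<bullet> (x - p)" by (simp add: inner_diff)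
    moreover have "d \<bullet> (x - x') \<ge> b * (d \<bullet> d)"
      using coco by (simp add: d_def power2_norm_eq_inner)
    \<comment> \<open>completing the square: this term is \<open>\<parallel>b d - (x - p) / 2\<parallel>\<^sup>2 / b\<close>\<close>
    moreover have "0 \<le> (1/b) * ((b *\<^sub>R d - (1/2) *\<^sub>R (x - p)) \<bullet> (b *\<^sub>R d - (1/2) *\<^sub>R (x - p)))"
      using b by simp
    moreover have "(1/b) * ((b *\<^sub>R d - (1/2) *\<^sub>R (x - p)) \<bullet> (b *\<^sub>R d - (1/2) *\<^sub>R (x - p)))
        = b * (d \<bullet> d) - d \<bullet> (x - p) + ((x - p) \<bullet> (x - p)) / (4 * b)"
    proof -
      define w where "w = x - p"
      show ?thesis unfolding w_def[symmetric] using b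
        by (simp add: inner_diff inner_commute field_simps)
    qed
    ultimately show ?thesis by (simp add: power2_norm_eq_inner)
  qed
  then have "m * (d \<bullet> (p - x')) \<ge> m * - ((norm (x - p))\<^sup>2 / (4 * b))"
    using m by (intro mult_left_mono) auto
  ultimately have "(norm (p - x'))\<^sup>2 \<le> (norm (x - x'))\<^sup>2 - (norm (x - p))\<^sup>2
      + 2 * (m * ((norm (x - p))\<^sup>2 / (4 * b)))" by linarith
  also have "\<dots> = (norm (x - x'))\<^sup>2 - (1 - m / (2 * b)) * (norm (x - p))\<^sup>2"
    using b by (simp add: field_simps)
  finally show ?thesis .
qed

text \<open>
  The distances to any solution decrease (Fejer monotonicity).  Their squares telescope, so
  consecutive iterates approach each other; this identifies every cluster point as a solution, and
  the distances to one that is a cluster point decrease to zero.  The gradient of the smooth part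
  enters only as a map \<open>D\<close> that is cocoercive on \<open>S\<close>, which suits a smooth part that is not
  convex or not differentiable elsewhere.
\<close>

theorem forward_backward_converges:
  fixes x :: "nat \<Rightarrow> 'a::euclidean_space" and g :: "'a \<Rightarrow> real" and D :: "'a \<Rightarrow> 'a"
  assumes S: "closed S" and g: "continuous_on S g"
    and b: "b > 0"
    and coco: "\<And>u v. u \<in> S \<Longrightarrow> v \<in> S \<Longrightarrow> b * (norm (D u - D v))\<^sup>2 \<le> (D u - D v) \<bullet> (u - v)"
    and m: "lo > 0" "hi < 2 * b" "\<And>t. lo \<le> m t" "\<And>t. m t \<le> hi"
    and xS: "\<And>t. x t \<in> S"
    and step: "\<And>t y. y \<in> S \<Longrightarrow>
      (x t - m t *\<^sub>R D (x t) - x (Suc t)) \<bullet> (y - x (Suc t)) \<le> m t * (g y - g (x (Suc t)))"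
    and sol: "x' \<in> S" "\<And>y. y \<in> S \<Longrightarrow> - (D x' \<bullet> (y - x')) \<le> g y - g x'"
  shows "\<exists>l\<in>S. (\<forall>y\<in>S. - (D l \<bullet> (y - l)) \<le> g y - g l) \<and> x \<longlonglongrightarrow> l"
proof -
  define c where "c = 1 - hi / (2 * b)"
  have c: "c > 0" using m(2) b by (simp add: c_def)
  have m0: "m t > 0" for t using m(1) m(3)[of t] by linarith
  have fejer: "(norm (x (Suc t) - s))\<^sup>2 \<le> (norm (x t - s))\<^sup>2 - c * (norm (x t - x (Suc t)))\<^sup>2"
    if "s \<in> S" "\<And>y. y \<in> S \<Longrightarrow> - (D s \<bullet> (y - s)) \<le> g y - g s" for s t
  proof -
    have "(norm (x (Suc t) - s))\<^sup>2
        \<le> (norm (x t - s))\<^sup>2 - (1 - m t / (2 * b)) * (norm (x t - x (Suc t)))\<^sup>2"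
      using coco[OF xS that(1)] step[OF that(1)] that(2)[OF xS] b m0
      by (intro forward_backward_step[where D = D and g = g]) auto
    moreover have "c \<le> 1 - m t / (2 * b)"
      using m(4)[of t] b by (simp add: c_def divide_right_mono)
    then have "c * (norm (x t - x (Suc t)))\<^sup>2 \<le> (1 - m t / (2 * b)) * (norm (x t - x (Suc t)))\<^sup>2"
      by (intro mult_right_mono) auto
    ultimately show ?thesis by linarith
  qed
  have mono: "decseq (\<lambda>t. norm (x t - s))"
    if "s \<in> S" "\<And>y. y \<in> S \<Longrightarrow> - (D s \<bullet> (y - s)) \<le> g y - g s" for s
  proof (rule decseq_SucI)
    fix t
    have "0 \<le> c * (norm (x t - x (Suc t)))\<^sup>2" using c by simp
    then have "(norm (x (Suc t) - s))\<^sup>2 \<le> (norm (x t - s))\<^sup>2" using fejer[OF that, of t] by linarith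
    then show "norm (x (Suc t) - s) \<le> norm (x t - s)" by (rule power2_le_imp_le) simp
  qed
  have diff0: "(\<lambda>t. x t - x (Suc t)) \<longlonglongrightarrow> 0"
  proof -
    obtain L where "(\<lambda>t. norm (x t - x')) \<longlonglongrightarrow> L"
      using decseq_convergent[OF mono[OF sol], of 0] by auto
    then have L: "(\<lambda>t. (norm (x t - x'))\<^sup>2) \<longlonglongrightarrow> L\<^sup>2" by (intro tendsto_intros)
    have drop: "(\<lambda>t. ((norm (x t - x'))\<^sup>2 - (norm (x (Suc t) - x'))\<^sup>2) / c) \<longlonglongrightarrow> (L\<^sup>2 - L\<^sup>2) / c"
      by (intro tendsto_intros L LIMSEQ_Suc[OF L]) (use c in auto)
    have "(\<lambda>t. (norm (x t - x (Suc t)))\<^sup>2) \<longlonglongrightarrow> 0"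
    proof (rule tendsto_sandwich[where f = "\<lambda>_. 0", OF _ _ tendsto_const])
      show "\<forall>\<^sub>F t in sequentially. (norm (x t - x (Suc t)))\<^sup>2
          \<le> ((norm (x t - x'))\<^sup>2 - (norm (x (Suc t) - x'))\<^sup>2) / c"
        using fejer[OF sol] c by (intro always_eventually) (simp add: field_simps)
    qed (use drop in simp_all)
    then have "(\<lambda>t. sqrt ((norm (x t - x (Suc t)))\<^sup>2)) \<longlonglongrightarrow> sqrt 0" by (intro tendsto_intros)
    then show ?thesis by (simp add: tendsto_norm_zero_iff)
  qed
  \<comment> \<open>cocoercivity and the Cauchy-Schwarz inequality make \<open>D\<close> Lipschitz on \<open>S\<close>\<close>
  have contD: "continuous_on S D"
  proof -
    have "b * norm (D u - D v) \<le> norm (u - v)" if "u \<in> S" "v \<in> S" for u v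
    proof (cases "D u = D v")
      case False
      have "b * norm (D u - D v) * norm (D u - D v) \<le> norm (u - v) * norm (D u - D v)"
        using coco[OF that] norm_cauchy_schwarz[of "D u - D v" "u - v"]
        by (simp add: power2_eq_square mult.commute mult.left_commute)
      then show ?thesis using False by simp
    qed simp
    then have "(1/b)-lipschitz_on S D"
      using b by (intro lipschitz_onI) (auto simp: dist_norm field_simps)
    then show ?thesis by (rule lipschitz_on_continuous_on)
  qed
  have "bounded (range x)"
  proof -
    have "norm (x t) \<le> norm (x 0 - x') + norm x'" for t
      using decseqD[OF mono[OF sol], of 0 t] norm_triangle_ineq[of "x t - x'" x'] by simp
    then show ?thesis by (auto simp: bounded_iff)
  qed
  then obtain l r where r: "strict_mono r" and lr: "(x \<circ> r) \<longlonglongrightarrow> l"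
    using bounded_imp_convergent_subsequence by blast
  have l: "l \<in> S" using closed_sequentially[OF S _ lr] xS by simp
  have lSuc: "(\<lambda>k. x (Suc (r k))) \<longlonglongrightarrow> l"
  proof -
    have "(\<lambda>k. x (r k) - x (Suc (r k))) \<longlonglongrightarrow> 0"
      using LIMSEQ_subseq_LIMSEQ[OF diff0 r] by (simp add: o_def)
    then show ?thesis using tendsto_diff[OF lr[unfolded o_def]] by fastforce
  qed
  have VI: "- (D l \<bullet> (y - l)) \<le> g y - g l" if y: "y \<in> S" for y
  proof -
    \<comment> \<open>dividing by \<open>m t\<close> removes the varying step size before passing to the limit; the lower bound
      on the step sizes keeps the quotient \<open>?w\<close> small\<close>
    let ?w = "\<lambda>t. (1 / m t) *\<^sub>R (x t - x (Suc t))"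
    have w0: "?w \<longlonglongrightarrow> 0"
    proof (rule tendsto_0_le[OF diff0, where K = "1/lo"], rule always_eventually, rule allI)
      fix t
      have "1 / m t \<le> 1 / lo" using m(1) m(3)[of t] by (simp add: frac_le)
      then show "norm (?w t) \<le> norm (x t - x (Suc t)) * (1 / lo)"
        using m0[of t] mult_right_mono[OF _ norm_ge_zero[of "x t - x (Suc t)"]]
        by (fastforce simp: mult.commute)
    qed
    have ineq: "(?w t - D (x t)) \<bullet> (y - x (Suc t)) \<le> g y - g (x (Suc t))" for t
    proof -
      have "m t * ((?w t - D (x t)) \<bullet> (y - x (Suc t)))
          = (x t - m t *\<^sub>R D (x t) - x (Suc t)) \<bullet> (y - x (Suc t))"
        using m0[of t] by (simp add: algebra_simps flip: inner_scaleR_left)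
      also have "\<dots> \<le> m t * (g y - g (x (Suc t)))" by (rule step[OF y])
      finally show ?thesis using m0[of t] by simp
    qed
    have wr: "(\<lambda>k. ?w (r k)) \<longlonglongrightarrow> 0"
      using LIMSEQ_subseq_LIMSEQ[OF w0 r] by (simp add: o_def)
    have Dr: "(\<lambda>k. D (x (r k))) \<longlonglongrightarrow> D l"
      using continuous_on_tendsto_compose[OF contD lr[unfolded o_def] l] xS by simp
    have gr: "(\<lambda>k. g (x (Suc (r k)))) \<longlonglongrightarrow> g l"
      using continuous_on_tendsto_compose[OF g lSuc l] xS by simp
    have "(0 - D l) \<bullet> (y - l) \<le> g y - g l"
    proof (rule tendsto_le[OF sequentially_bot])
      show "(\<lambda>k. (?w (r k) - D (x (r k))) \<bullet> (y - x (Suc (r k)))) \<longlonglongrightarrow> (0 - D l) \<bullet> (y - l)"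
        by (intro tendsto_intros wr Dr lSuc)
      show "(\<lambda>k. g y - g (x (Suc (r k)))) \<longlonglongrightarrow> g y - g l"
        by (intro tendsto_intros gr)
      show "\<forall>\<^sub>F k in sequentially. (?w (r k) - D (x (r k))) \<bullet> (y - x (Suc (r k)))
          \<le> g y - g (x (Suc (r k)))"
        using ineq by simp
    qed
    then show ?thesis by simp
  qed
  have "x \<longlonglongrightarrow> l"
  proof -
    obtain L where L: "(\<lambda>t. norm (x t - l)) \<longlonglongrightarrow> L"
      using decseq_convergent[OF mono[OF l VI], of 0] by auto
    then have "(\<lambda>k. norm (x (r k) - l)) \<longlonglongrightarrow> L"
      using LIMSEQ_subseq_LIMSEQ[OF L r] by (simp add: o_def)
    moreover have "(\<lambda>k. norm (x (r k) - l)) \<longlonglongrightarrow> norm (l - l)"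
      by (intro tendsto_intros lr[unfolded o_def])
    ultimately have "L = 0" using LIMSEQ_unique by fastforce
    then show ?thesis using L by (simp add: tendsto_norm_zero_iff LIM_zero_iff)
  qed
  with l VI show ?thesis by blast
qed

section \<open>The Poisson fidelity term\<close>

text \<open>
  With \<open>p = \<surd>a\<close> and \<open>q = \<surd>b\<close>, the summand exceeds its tangent by \<open>z (p - q)\<^sup>2 / p\<close>.
\<close>

lemma fidelity_summand_gradient_inequality:
  fixes z a b :: real
  assumes "z \<ge> 0" "a > 0" "b > 0"
  shows "1/2 * (z - 2 * sqrt a)\<^sup>2 + (- z / sqrt a + 2) * (b - a) \<le> 1/2 * (z - 2 * sqrt b)\<^sup>2"
proof -
  define p q where "p = sqrt a" and "q = sqrt b"
  have pq: "p > 0" "q > 0" "a = p\<^sup>2" "b = q\<^sup>2" using assms by (auto simp: p_def q_def)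
  have "1/2 * (z - 2 * q)\<^sup>2 - (1/2 * (z - 2 * p)\<^sup>2 + (- z / p + 2) * (q\<^sup>2 - p\<^sup>2)) = z * (p - q)\<^sup>2 / p"
    using pq(1) by (simp add: field_simps power2_eq_square)
  moreover have "0 \<le> z * (p - q)\<^sup>2 / p" using assms(1) pq(1) by simp
  ultimately have "1/2 * (z - 2 * p)\<^sup>2 + (- z / p + 2) * (q\<^sup>2 - p\<^sup>2) \<le> 1/2 * (z - 2 * q)\<^sup>2"
    by linarith
  then show ?thesis using assms(2,3) by (simp add: p_def q_def)
qed

text \<open>
  With \<open>p = \<surd>a\<close> and \<open>q = \<surd>b\<close> one has \<open>d = z (p - q) / (p q)\<close> and \<open>a - b = (p - q) (p + q)\<close>, so
  the quotient of \<open>d (a - b)\<close> and \<open>d\<^sup>2\<close> is \<open>(p + q) p q / z\<close>, which is smallest at \<open>p = q = \<surd>c\<close>.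
\<close>

lemma fidelity_summand_cocoercive:
  fixes z Z a b c :: real
  assumes "0 < z" "z \<le> Z" "0 < c" "c \<le> a" "c \<le> b"
  defines "d \<equiv> (- z / sqrt a + 2) - (- z / sqrt b + 2)"
  shows "2 * sqrt c ^ 3 / Z * d\<^sup>2 \<le> d * (a - b)"
proof -
  define p q s where "p = sqrt a" and "q = sqrt b" and "s = sqrt c"
  have pq: "p > 0" "q > 0" "s > 0" "a = p\<^sup>2" "b = q\<^sup>2" "s \<le> p" "s \<le> q"
    using assms by (auto simp: p_def q_def s_def)
  have d: "d = z * (p - q) / (p * q)"
    using pq unfolding d_def p_def[symmetric] q_def[symmetric] by (simp add: field_simps)
  have s3: "2 * s ^ 3 \<le> (p + q) * (p * q)"
  proof -
    have "(s + s) * (s * s) \<le> (p + q) * (p * q)" using pq by (intro mult_mono add_mono) auto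
    then show ?thesis by (simp add: power3_eq_cube)
  qed
  have "2 * s ^ 3 / Z \<le> (p + q) * (p * q) / z"
    using s3 assms(1,2) pq by (intro frac_le) auto
  then have "2 * s ^ 3 / Z * d\<^sup>2 \<le> (p + q) * (p * q) / z * d\<^sup>2"
    by (intro mult_right_mono) auto
  also have "\<dots> = d * (a - b)"
    unfolding d pq(4,5) using pq assms(1) by (simp add: field_simps power2_eq_square)
  finally show ?thesis by (simp add: s_def)
qed

lemma fidelity_gradient_inequality:
  assumes "\<And>i. 0 \<le> z $ i" "\<And>i. 0 \<le> \<eta> $ i" "\<And>i. 0 \<le> \<theta> $ i"
  shows "fidelity z \<eta> + grad_fidelity z \<eta> \<bullet> (\<theta> - \<eta>) \<le> fidelity z \<theta>"
proof -
  have "1/2 * (z $ i - 2 * sqrt (\<eta> $ i + 3/8))\<^sup>2 + grad_fidelity z \<eta> $ i * (\<theta> - \<eta>) $ i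
      \<le> 1/2 * (z $ i - 2 * sqrt (\<theta> $ i + 3/8))\<^sup>2" for i
    using fidelity_summand_gradient_inequality[OF assms(1), of "\<eta> $ i + 3/8" "\<theta> $ i + 3/8" i] assms
    by (simp add: grad_fidelity_def add_nonneg_pos)
  then show ?thesis
    unfolding fidelity_def inner_vec_def inner_real_def sum.distrib[symmetric]
    by (intro sum_mono) simp
qed

lemma fidelity_cocoercive:
  assumes "\<And>i. 0 < z $ i" "\<And>i. z $ i \<le> Z" "\<And>i. 0 \<le> \<eta> $ i" "\<And>i. 0 \<le> \<theta> $ i"
  defines "d \<equiv> grad_fidelity z \<eta> - grad_fidelity z \<theta>"
  shows "2 * sqrt (3/8) ^ 3 / Z * (norm d)\<^sup>2 \<le> d \<bullet> (\<eta> - \<theta>)"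
proof -
  have "2 * sqrt (3/8) ^ 3 / Z * (d $ i)\<^sup>2 \<le> d $ i * (\<eta> - \<theta>) $ i" for i
    using fidelity_summand_cocoercive[OF assms(1,2), of "3/8" "\<eta> $ i + 3/8" "\<theta> $ i + 3/8" i] assms(3,4)
    by (simp add: grad_fidelity_def d_def)
  then show ?thesis
    unfolding power2_norm_eq_inner inner_vec_def inner_real_def sum_distrib_left
    by (intro sum_mono) (simp add: power2_eq_square)
qed

lemma circ_conv_nonneg:
  assumes "psf h" "x \<in> positive_orthant"
  shows "0 \<le> (h \<circledast> x) $ i"
  unfolding circ_conv_def vec_lambda_beta
  using assms by (intro sum_nonneg mult_nonneg_nonneg) (simp_all only: psf_def positive_orthant_def mem_Collect_eq)

lemma norm_adjoint_le:
  fixes f :: "'a::euclidean_space \<Rightarrow> 'b::euclidean_space"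
  assumes "linear f"
  shows "norm (adjoint f w) \<le> onorm f * norm w"
proof (cases "adjoint f w = 0")
  case True
  then show ?thesis
    using onorm_pos_le[of f] assms by (simp add: linear_conv_bounded_linear)
next
  case False
  let ?v = "adjoint f w"
  have "norm ?v * norm ?v = f ?v \<bullet> w"
    using adjoint_works[OF assms, of ?v w] by (simp add: inner_commute flip: power2_eq_square power2_norm_eq_inner)
  also have "\<dots> \<le> norm (f ?v) * norm w" by (rule norm_cauchy_schwarz)
  also have "\<dots> \<le> onorm f * norm ?v * norm w"
    using onorm[of f ?v] assms by (intro mult_right_mono) (auto simp: linear_conv_bounded_linear)
  finally have "norm ?v * norm ?v \<le> (onorm f * norm w) * norm ?v" by (simp add: ac_simps)
  then show ?thesis using False by simp
qed

lemma norm_tight_frame_analysis: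
  fixes \<Phi> :: "real ^ 'l ^ 'n"
  assumes "tight_frame_dictionary A \<Phi>"
  shows "(norm (transpose \<Phi> *v v))\<^sup>2 = A * (norm v)\<^sup>2"
proof -
  have "(transpose \<Phi> *v v) \<bullet> (transpose \<Phi> *v v) = v \<bullet> ((\<Phi> ** transpose \<Phi>) *v v)"
    using dot_lmul_matrix[of v \<Phi> "transpose \<Phi> *v v"] by (simp flip: matrix_vector_mul_assoc)
  also have "\<dots> = v \<bullet> (A *\<^sub>R v)"
  proof -
    have "(mat A :: real ^ 'n ^ 'n) *v v = A *\<^sub>R v"
      by (simp add: mat_def matrix_vector_mult_def vec_eq_iff if_distrib if_distribR cong: if_cong)
    then show ?thesis using assms by (simp add: tight_frame_dictionary_def)
  qed
  finally show ?thesis by (simp add: power2_norm_eq_inner)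
qed

text \<open>
  Identifies the operator applied to the fidelity gradient in \<^const>\<open>grad_f1\<close> as the adjoint of
  \<open>v \<mapsto> h \<circledast> \<Phi>v\<close>.  This transfers first-order properties of the fidelity to \<^const>\<open>f1\<close>.
\<close>

lemma inner_conv_synthesis:
  "(h \<circledast> (\<Phi> *v v)) \<bullet> w = v \<bullet> (transpose \<Phi> *v adjoint ((\<circledast>) h) w)"
  using adjoint_works[OF linear_circ_conv, of "\<Phi> *v v" h w]
  by (simp add: inner_commute dot_lmul_matrix flip: vector_transpose_matrix)

lemma linear_conv_synthesis: "linear (\<lambda>v. h \<circledast> (\<Phi> *v v))"
  using linear_compose[OF matrix_vector_mul_linear linear_circ_conv] by (simp add: o_def)

lemma f1_gradient_inequality:
  assumes "psf h" "\<And>i. 0 \<le> z $ i"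
    and "\<Phi> *v u \<in> positive_orthant" "\<Phi> *v v \<in> positive_orthant"
  shows "f1 h \<Phi> z u + grad_f1 h \<Phi> z u \<bullet> (v - u) \<le> f1 h \<Phi> z v"
  using fidelity_gradient_inequality[OF assms(2) circ_conv_nonneg[OF assms(1,3)]
      circ_conv_nonneg[OF assms(1,4)]]
    inner_conv_synthesis[of h \<Phi> "v - u" "grad_fidelity z (h \<circledast> (\<Phi> *v u))"]
    linear_diff[OF linear_conv_synthesis, of h \<Phi> v u]
  by (simp add: f1_def grad_f1_def inner_commute)

text \<open>
  Writing \<open>T = H\<Phi>\<close> and \<open>d = T\<^sup>* e\<close>, where \<open>e\<close> is the difference of the fidelity gradients, the
  inner product \<open>d \<bullet> (u - v)\<close> equals \<open>e \<bullet> (T u - T v)\<close>.  So cocoercivity carries over, with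
  \<open>\<parallel>e\<parallel>\<^sup>2\<close> estimated from below through \<open>\<parallel>T\<^sup>* e\<parallel>\<^sup>2 \<le> A \<parallel>H\<parallel>\<^sup>2 \<parallel>e\<parallel>\<^sup>2\<close>.
\<close>

lemma grad_f1_cocoercive:
  assumes h: "psf h" and A: "tight_frame_dictionary A \<Phi>" and H: "onorm ((\<circledast>) h) > 0"
    and z: "\<And>i. 0 < z $ i" "\<And>i. z $ i \<le> Z"
    and uv: "\<Phi> *v u \<in> positive_orthant" "\<Phi> *v v \<in> positive_orthant"
  defines "d \<equiv> grad_f1 h \<Phi> z u - grad_f1 h \<Phi> z v"
  shows "2 * sqrt (3/8) ^ 3 / (A * (onorm ((\<circledast>) h))\<^sup>2 * Z) * (norm d)\<^sup>2 \<le> d \<bullet> (u - v)"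
proof -
  let ?T = "\<lambda>v. h \<circledast> (\<Phi> *v v)" and ?H = "onorm ((\<circledast>) h)"
  define e where "e = grad_fidelity z (?T u) - grad_fidelity z (?T v)"
  have A0: "A > 0" using A by (simp add: tight_frame_dictionary_def)
  have Z0: "Z > 0" using z[of undefined] by linarith
  have lin: "linear (adjoint ((\<circledast>) h))" by (rule adjoint_linear[OF linear_circ_conv])
  have d: "d = transpose \<Phi> *v adjoint ((\<circledast>) h) e"
    by (simp add: d_def e_def grad_f1_def linear_diff[OF lin] matrix_vector_mult_diff_distrib)
  have "d \<bullet> (u - v) = ?T (u - v) \<bullet> e"
    unfolding d inner_conv_synthesis by (rule inner_commute)
  also have "\<dots> = e \<bullet> (?T u - ?T v)"
    using linear_diff[OF linear_conv_synthesis, of h \<Phi> u v] by (simp add: inner_commute)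
  also have "\<dots> \<ge> 2 * sqrt (3/8) ^ 3 / Z * (norm e)\<^sup>2"
    unfolding e_def
    by (intro fidelity_cocoercive z circ_conv_nonneg[OF h] uv)
  finally have *: "2 * sqrt (3/8) ^ 3 / Z * (norm e)\<^sup>2 \<le> d \<bullet> (u - v)" .
  have "(norm d)\<^sup>2 = A * (norm (adjoint ((\<circledast>) h) e))\<^sup>2"
    unfolding d by (rule norm_tight_frame_analysis[OF A])
  also have "\<dots> \<le> A * (?H * norm e)\<^sup>2"
    using A0 norm_adjoint_le[OF linear_circ_conv, of h e] by (intro mult_left_mono power_mono) auto
  finally have "(norm d)\<^sup>2 / (A * ?H\<^sup>2) \<le> (norm e)\<^sup>2"
    using A0 H by (simp add: field_simps power_mult_distrib)
  then have "2 * sqrt (3/8) ^ 3 / Z * ((norm d)\<^sup>2 / (A * ?H\<^sup>2)) \<le> 2 * sqrt (3/8) ^ 3 / Z * (norm e)\<^sup>2"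
    using Z0 by (intro mult_left_mono) auto
  with * show ?thesis by (simp add: field_simps)
qed

lemma continuous_on_f1: "continuous_on UNIV (f1 h \<Phi> z)"
  unfolding f1_def[abs_def] fidelity_def
  by (intro continuous_intros continuous_on_component linear_continuous_on
      linear_conv_synthesis[unfolded linear_conv_bounded_linear])

section \<open>Convergence for the deconvolution problem\<close>

lemma convex_on_sum_components:
  assumes "convex_on UNIV \<psi>"
  shows "convex_on UNIV (\<lambda>\<alpha> :: real ^ 'l. \<Sum>i\<in>UNIV. \<psi> (\<alpha> $ i))"
proof (rule convex_onI)
  fix t :: real and u v :: "real ^ 'l"
  assume t: "0 < t" "t < 1"
  show "(\<Sum>i\<in>UNIV. \<psi> (((1 - t) *\<^sub>R u + t *\<^sub>R v) $ i))
      \<le> (1 - t) * (\<Sum>i\<in>UNIV. \<psi> (u $ i)) + t * (\<Sum>i\<in>UNIV. \<psi> (v $ i))"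
    unfolding sum_distrib_left sum.distrib[symmetric]
    using t convex_onD[OF assms, of t] by (intro sum_mono) auto
qed simp

lemma closed_convex_nonneg_synthesis:
  fixes \<Phi> :: "real ^ 'l ^ 'n"
  shows "closed {\<alpha>. \<Phi> *v \<alpha> \<in> positive_orthant}" "convex {\<alpha>. \<Phi> *v \<alpha> \<in> positive_orthant}"
proof -
  show "closed {\<alpha>. \<Phi> *v \<alpha> \<in> positive_orthant}"
    unfolding positive_orthant_def mem_Collect_eq
    by (intro closed_Collect_all closed_Collect_le continuous_intros continuous_on_component
        matrix_vector_mult_linear_continuous_on)
  show "convex {\<alpha>. \<Phi> *v \<alpha> \<in> positive_orthant}"
    by (auto simp: convex_def positive_orthant_def matrix_vector_right_distrib
        matrix_vector_mult_scaleR)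
qed

theorem theorem1:
  fixes h :: "'m::finite image"
    and y :: "nat ^ 'm pixel"
    and \<Phi> :: "real ^ 'l ^ 'm pixel"
    and A lam :: real
    and \<psi> :: "real \<Rightarrow> real"
    and \<mu> :: "nat \<Rightarrow> real"
    and \<alpha> :: "nat \<Rightarrow> real ^ 'l"
  defines "z \<equiv> anscombe y"
  defines "J \<equiv> (\<lambda>\<beta>. ereal (f1 h \<Phi> z \<beta>) + f2 \<Phi> lam \<psi> \<beta>)"
  assumes "psf h"
    and "tight_frame_dictionary A \<Phi>"
    and "lam > 0"
    and "convex_on UNIV \<psi>"
    and "coercive J"
    and "\<And>t. \<mu> t > 0"
    and "0 < (INF t. ereal (\<mu> t))"
    and "(SUP t. ereal (\<mu> t))
           < ereal ((3/2) powr (3/2) / (2 * A * (onorm ((\<circledast>) h))\<^sup>2 * infnorm z))"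
    and "\<And>t. \<alpha> (Suc t) =
           prox (\<lambda>\<beta>. ereal (\<mu> t) * f2 \<Phi> lam \<psi> \<beta>) (\<alpha> t - \<mu> t *\<^sub>R grad_f1 h \<Phi> z (\<alpha> t))"
  shows "\<exists>\<alpha>'. is_minimizer J \<alpha>' \<and> \<alpha> \<longlonglongrightarrow> \<alpha>'"
proof -
  define S where "S = {\<beta>. \<Phi> *v \<beta> \<in> positive_orthant}"
  define g where "g = (\<lambda>\<beta> :: real ^ 'l. lam * (\<Sum>i\<in>UNIV. \<psi> (\<beta> $ i)))"
  let ?f = "f1 h \<Phi> z" and ?D = "grad_f1 h \<Phi> z" and ?H = "onorm ((\<circledast>) h)"
  have S: "closed S" "convex S" "0 \<in> S"
    using closed_convex_nonneg_synthesis[of \<Phi>] by (auto simp: S_def positive_orthant_def)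
  then have Sne: "S \<noteq> {}" by blast
  have gU: "convex_on UNIV g"
    unfolding g_def using convex_on_sum_components[OF assms(6)] \<open>lam > 0\<close>
    by (intro convex_on_cmul) auto
  have gS: "convex_on S g" using gU S(2) by (meson convex_on_subset top_greatest)
  have g_cont: "continuous_on S g"
    using convex_on_continuous[OF open_UNIV gU] continuous_on_subset by blast
  have f2: "f2 \<Phi> lam \<psi> \<beta> = (if \<beta> \<in> S then ereal (g \<beta>) else \<infinity>)" for \<beta>
    by (simp add: f2_def S_def g_def indicator_fun_def)
  have J: "J = (\<lambda>\<beta>. if \<beta> \<in> S then ereal (?f \<beta> + g \<beta>) else \<infinity>)"
    by (auto simp: J_def f2)
  have z0: "0 < z $ i" for i by (simp add: z_def anscombe_def add_nonneg_pos)
  have zZ: "z $ i \<le> infnorm z" for i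
    using component_le_infnorm_cart[of z i] by simp
  have Z0: "infnorm z > 0" using z0[of undefined] zZ[of undefined] by linarith
  have A0: "A > 0" using assms(4) by (simp add: tight_frame_dictionary_def)

  obtain lo where lo: "lo > 0" "\<And>t. lo \<le> \<mu> t"
  proof -
    obtain e where e: "0 < e" "e < (INF t. ereal (\<mu> t))" using dense[OF assms(9)] by blast
    have "e < ereal (\<mu> t)" for t using e(2) INF_lower[of t UNIV] by (metis UNIV_I less_le_trans)
    then show thesis using that[of "real_of_ereal e"] e(1) by (cases e) (auto intro: less_imp_le)
  qed
  define hi where "hi = real_of_ereal (SUP t. ereal (\<mu> t))"
  have "ereal (\<mu> t) \<le> (SUP t. ereal (\<mu> t))" for t by (rule SUP_upper) simp
  then have hi: "\<mu> t \<le> hi" and hi_less: "hi < (3/2) powr (3/2) / (2 * A * ?H\<^sup>2 * infnorm z)" for t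
    using assms(10) unfolding hi_def
    by (cases "SUP t. ereal (\<mu> t)"; force)+
  \<comment> \<open>if \<open>?H\<close> vanished, the bound on the step sizes would be a division by zero, that is \<open>0\<close>\<close>
  have H: "?H > 0"
  proof -
    have "hi > 0" using hi[of 0] assms(8)[of 0] by linarith
    then have "?H \<noteq> 0" using hi_less by auto
    moreover have "?H \<ge> 0"
      using linear_circ_conv[of h] by (intro onorm_pos_le) (simp add: linear_conv_bounded_linear)
    ultimately show ?thesis by simp
  qed
  define b where "b = 2 * sqrt (3/8) ^ 3 / (A * ?H\<^sup>2 * infnorm z)"
  have b: "b > 0" using A0 H Z0 by (simp add: b_def)
  \<comment> \<open>the constants agree because \<open>3/2 = 2\<^sup>2 (3/8)\<close>\<close>
  have "hi < 2 * b"
  proof -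
    have "(3/2 :: real) powr (3/2) = sqrt (3/2) ^ 3"
      by (simp add: powr_half_sqrt[symmetric] powr_powr flip: powr_realpow)
    also have "\<dots> = 8 * sqrt (3/8) ^ 3"
    proof -
      have "sqrt (3/2) = sqrt (2\<^sup>2 * (3/8))" by simp
      also have "\<dots> = 2 * sqrt (3/8)" by (subst real_sqrt_mult) simp
      finally show ?thesis by (simp add: power_mult_distrib)
    qed
    finally show ?thesis using hi_less by (simp add: b_def ac_simps)
  qed

  have next_prox: "\<alpha> (Suc t) = prox (\<lambda>\<beta>. if \<beta> \<in> S then ereal (\<mu> t * g \<beta>) else \<infinity>) (\<alpha> t - \<mu> t *\<^sub>R ?D (\<alpha> t))"
    for t
    unfolding assms(11)[of t] by (rule arg_cong2[where f = prox]) (use assms(8)[of t] in \<open>auto simp: f2\<close>)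
  have \<mu>g: "convex_on UNIV (\<lambda>\<beta>. \<mu> t * g \<beta>)" for t
    using gU assms(8)[of t] by (intro convex_on_cmul) auto
  have in_S: "\<alpha> (Suc t) \<in> S" for t
    unfolding next_prox by (rule prox_variational_inequality(1)[OF S(1,2) Sne \<mu>g])
  have step: "(\<alpha> t - \<mu> t *\<^sub>R ?D (\<alpha> t) - \<alpha> (Suc t)) \<bullet> (y - \<alpha> (Suc t)) \<le> \<mu> t * (g y - g (\<alpha> (Suc t)))"
    if "y \<in> S" for t y
    using prox_variational_inequality(2)[OF S(1,2) Sne \<mu>g that, of "\<alpha> t - \<mu> t *\<^sub>R ?D (\<alpha> t)" t]
    unfolding next_prox[symmetric] by (simp add: right_diff_distrib)

  \<comment> \<open>on \<open>S\<close> the convolution is nonnegative, so \<^const>\<open>grad_f1\<close> is the gradient there\<close>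
  have min_iff: "is_minimizer J p \<longleftrightarrow> p \<in> S \<and> (\<forall>y\<in>S. - (?D p \<bullet> (y - p)) \<le> g y - g p)" for p
  proof -
    have "is_minimizer J p \<longleftrightarrow> p \<in> S \<and> (\<forall>y\<in>S. ?f p + g p \<le> ?f y + g y)"
      unfolding J by (rule is_minimizer_extended_iff[OF Sne])
    also have "\<dots> \<longleftrightarrow> p \<in> S \<and> (\<forall>y\<in>S. - (?D p \<bullet> (y - p)) \<le> g y - g p)"
    proof (intro conj_cong refl iffI ballI)
      fix y assume p: "p \<in> S" and y: "y \<in> S" and min: "\<forall>y\<in>S. ?f p + g p \<le> ?f y + g y"
      have "(h \<circledast> (\<Phi> *v p)) $ i > - 3/8" for i
        using circ_conv_nonneg[OF assms(3), of "\<Phi> *v p" i] p by (simp add: S_def)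
      then show "- (?D p \<bullet> (y - p)) \<le> g y - g p"
        using min p y by (intro minimizer_variational_inequality[OF GDERIV_f1 gS]) auto
    next
      fix y assume p: "p \<in> S" and y: "y \<in> S" and VI: "\<forall>y\<in>S. - (?D p \<bullet> (y - p)) \<le> g y - g p"
      have "?f p + ?D p \<bullet> (y - p) \<le> ?f y"
        using p y z0 by (intro f1_gradient_inequality assms(3)) (auto simp: S_def less_imp_le)
      then show "?f p + g p \<le> ?f y + g y" using VI y by force
    qed
    finally show ?thesis .
  qed

  obtain x' where x': "is_minimizer J x'"
  proof -
    have "\<forall>\<^sub>F x in at_infinity. ereal (?f 0 + g 0) < J x"
      using assms(7) by (simp add: coercive_def tendsto_PInfty)
    then obtain R where R: "\<And>x. R \<le> norm x \<Longrightarrow> ereal (?f 0 + g 0) < J x"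
      by (auto simp: eventually_at_infinity)
    have "continuous_on S (\<lambda>x. ?f x + g x)"
      by (intro continuous_intros g_cont continuous_on_subset[OF continuous_on_f1]) auto
    moreover have "?f 0 + g 0 \<le> ?f x + g x" if "x \<in> S" "R \<le> norm x" for x
      using R[OF that(2)] that(1) by (simp add: J)
    ultimately have "\<exists>p\<in>S. \<forall>y\<in>S. ?f p + g p \<le> ?f y + g y"
      by (intro continuous_coercive_attains_inf[OF S(1,3)]) auto
    then obtain p where "p \<in> S \<and> (\<forall>y\<in>S. ?f p + g p \<le> ?f y + g y)" by blast
    then have "is_minimizer J p" unfolding J by (rule is_minimizer_extended_iff[OF Sne, THEN iffD2])
    then show thesis by (rule that)
  qed
  have "\<exists>l\<in>S. (\<forall>y\<in>S. - (?D l \<bullet> (y - l)) \<le> g y - g l) \<and> (\<lambda>t. \<alpha> (Suc t)) \<longlonglongrightarrow> l"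
  proof (rule forward_backward_converges[where m = "\<lambda>t. \<mu> (Suc t)" and x' = x'])
    show "closed S" "continuous_on S g" "b > 0" "lo > 0" "hi < 2 * b"
      by (fact S(1) g_cont b lo(1) \<open>hi < 2 * b\<close>)+
    show "lo \<le> \<mu> (Suc t)" "\<mu> (Suc t) \<le> hi" "\<alpha> (Suc t) \<in> S" for t
      by (fact lo(2) hi in_S)+
    show "x' \<in> S" "\<And>y. y \<in> S \<Longrightarrow> - (?D x' \<bullet> (y - x')) \<le> g y - g x'"
      using x' min_iff by blast+
    show "b * (norm (?D u - ?D v))\<^sup>2 \<le> (?D u - ?D v) \<bullet> (u - v)" if "u \<in> S" "v \<in> S" for u v
      using that unfolding b_def S_def
      by (intro grad_f1_cocoercive assms(3,4) H z0 zZ) auto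
  qed (fact step)
  then obtain l where "is_minimizer J l" "(\<lambda>t. \<alpha> (Suc t)) \<longlonglongrightarrow> l"
    using min_iff by blast
  then show ?thesis using LIMSEQ_imp_Suc by blast
qed

end
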